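(* Let $n\ge1$, let $0<\varepsilon<1$ be real, let $m\ge 1$ be an integer, and let $\mathcal{D}$ be a probability distribution on $[0,1]^n$. Let the value vectors of the items $e_1,\dots,e_m$ be drawn independently from $\mathcal{D}$, let $\sigma$ be the resulting input sequence, and let $\mathrm{Opt}=\mathbb{E}[\mathrm{OPT}(\sigma)]$. If $$\mathrm{Opt}\ge \frac{2}{\varepsilon^2}\log\frac{n}{\varepsilon},$$ then the online deterministic algorithm $\mathcal{B}_\varepsilon$ (defined in the context) satisfies $$\mathbb{E}\Bigl[\min_{i\in N}v_i(A_i)\Bigr]\ \ge\ (1-2\varepsilon)\,\mathrm{Opt},$$ where $A=(A_1,\dots,A_n)$ is the allocation it returns on $\sigma$.
   Context: Setting (online max-min fair allocation, unknown i.i.d. arrival). There are agents $N=\{1,\dots,n\}$; items $e_1,\dots,e_m$ arrive one by one. The value vector $(v_1(e_j),\dots,v_n(e_j))\in[0,1]^n$ of $e_j$ is revealed on arrival and $e_j$ must be irrevocably given to one agent. Valuations are additive: $v_i(X)=\sum_{e\in X}v_i(e)$. The distribution $\mathcal{D}$ and the number $m$ are unknown to the algorithm; $\mathcal{D}$ may be discrete or continuous. $\mathrm{OPT}(\sigma)$ is the maximum over all allocations (partitions of the items into $n$ possibly empty parts $A_1,\dots,A_n$) of $\min_{i\in N}v_i(A_i)$. $\log$ is the natural logarithm. Algorithm $\mathcal{B}_\varepsilon$. Let $A_i^{(0)}=\emptyset$ for all $i\in N$. When $e_j$ arrives, allocate it to an agent $i^{(j)}\in\arg\max_{i\in N}\,(1-\varepsilon)^{v_i(A_i^{(j-1)})}\,v_i(e_j)$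 (ties broken arbitrarily), i.e. $A_i^{(j)}=A_i^{(j-1)}\cup\{e_j\}$ if $i=i^{(j)}$ and $A_i^{(j)}=A_i^{(j-1)}$ otherwise. The returned allocation is $A_i=A_i^{(m)}$. *)

theory Defs
  imports "HOL-Probability.Probability"
begin

text \<open>Agents are the elements of the finite type \<open>'n\<close>. Items are numbered from \<open>0\<close>, and an input
  sequence \<open>\<sigma>\<close> gives the value vector \<open>\<sigma> j\<close> of item \<open>j\<close>, so that \<open>\<sigma> j $ i\<close> is the value of item
  \<open>j\<close> for agent \<open>i\<close>. Bundles are sets of item numbers.\<close>

definition unit_cube :: "(real ^ 'n) set" where
  "unit_cube = {v. \<forall>i. 0 \<le> v $ i \<and> v $ i \<le> 1}"

definition valuation :: "(nat \<Rightarrow> real ^ 'n) \<Rightarrow> 'n \<Rightarrow> nat set \<Rightarrow> real" where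
  "valuation \<sigma> i X = (\<Sum>e\<in>X. \<sigma> e $ i)"

definition min_value :: "(nat \<Rightarrow> real ^ 'n::finite) \<Rightarrow> ('n \<Rightarrow> nat set) \<Rightarrow> real" where
  "min_value \<sigma> A = (MIN i. valuation \<sigma> i (A i))"

definition allocations :: "nat \<Rightarrow> ('n \<Rightarrow> nat set) set" where
  "allocations m = {A. disjoint_family A \<and> (\<Union>i. A i) = {..<m}}"

definition OPT :: "nat \<Rightarrow> (nat \<Rightarrow> real ^ 'n::finite) \<Rightarrow> real" where
  "OPT m \<sigma> = (MAX A\<in>allocations m. min_value \<sigma> A)"

text \<open>A deterministic online rule \<open>d\<close> gives item \<open>j\<close> to agent \<open>d j h\<close>, where the history \<open>h\<close>
  consists of the value vectors of the items \<open>0, \<dots>, j\<close> only.\<close>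

type_synonym 'n online_rule = "nat \<Rightarrow> (nat \<Rightarrow> real ^ 'n) \<Rightarrow> 'n"

definition recipient :: "'n online_rule \<Rightarrow> (nat \<Rightarrow> real ^ 'n) \<Rightarrow> nat \<Rightarrow> 'n" where
  "recipient d \<sigma> j = d j (restrict \<sigma> {..j})"

text \<open>\<open>bundles d \<sigma> j i\<close> is the bundle of agent \<open>i\<close> after the first \<open>j\<close> items.\<close>

primrec bundles :: "'n online_rule \<Rightarrow> (nat \<Rightarrow> real ^ 'n) \<Rightarrow> nat \<Rightarrow> 'n \<Rightarrow> nat set" where
  "bundles d \<sigma> 0 = (\<lambda>i. {})"
| "bundles d \<sigma> (Suc j) =
     (\<lambda>i. if i = recipient d \<sigma> j then insert j (bundles d \<sigma> j i) else bundles d \<sigma> j i)"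

text \<open>The algorithm determines the recipient only up to ties, so it is a predicate on
  online rules: the rules satisfying it correspond to the possible ways of breaking ties, which
  may depend on everything seen so far.\<close>

definition is_alg_B :: "real \<Rightarrow> 'n::finite online_rule \<Rightarrow> bool" where
  "is_alg_B \<epsilon> d \<longleftrightarrow>
     (\<forall>\<sigma>. range \<sigma> \<subseteq> unit_cube \<longrightarrow>
       (\<forall>j. is_arg_max (\<lambda>i. (1 - \<epsilon>) powr valuation \<sigma> i (bundles d \<sigma> j i) * \<sigma> j $ i)
              (\<lambda>i. True) (recipient d \<sigma> j)))"

end

theory Submission
  imports Defs
begin

text \<open>
  Let \<open>\<Phi>\<^sub>k = \<Sum>i. (1 - \<epsilon>) powr v\<^sub>i(A\<^sub>i)\<close> after \<open>k\<close> items. By convexity, the item \<open>y\<close> decreases the potential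
  by at least \<open>\<epsilon>\<close> times the greedy score \<open>max\<^sub>i w\<^sub>i y\<^sub>i\<close>, where \<open>w\<^sub>i\<close> is the summand of agent \<open>i\<close>. For
  fixed weights \<open>w\<close>, an optimal allocation of \<open>m\<close> fresh items collects at least \<open>(\<Sum>i. w\<^sub>i) OPT\<close> in
  weighted value, so the expected greedy score of one item is at least \<open>(\<Sum>i. w\<^sub>i) Opt / m\<close>. Since
  each item is independent of the past, \<open>E \<Phi>\<^sub>k\<close> shrinks by a factor \<open>1 - \<epsilon> Opt / m\<close> per item, whence
  \<open>E \<Phi>\<^sub>m \<le> n exp (- \<epsilon> Opt)\<close>. As \<open>\<Phi>\<^sub>m\<close> dominates \<open>(1 - \<epsilon>) powr min\<^sub>i v\<^sub>i(A\<^sub>i)\<close>, Jensen's inequality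
  bounds the expected minimum from below.
\<close>

text \<open>The convex function \<open>v \<mapsto> (1 - \<epsilon>) powr v\<close> lies below its
  chord on [0,1], whose end values are 1 and \<open>1 - \<epsilon>\<close>.\<close>

lemma powr_le_linear_interpolation:
  fixes \<epsilon> v :: real
  assumes "0 < \<epsilon>" "\<epsilon> < 1" "0 \<le> v" "v \<le> 1"
  shows "(1 - \<epsilon>) powr v \<le> 1 - \<epsilon> * v"
proof -
  have "exp ((1 - v) * 0 + v * ln (1 - \<epsilon>)) \<le> (1 - v) * exp 0 + v * exp (ln (1 - \<epsilon>))"
    using convex_onD[OF exp_convex, of v 0 "ln (1 - \<epsilon>)"] assms by simp
  then show ?thesis
    using assms by (simp add: powr_def algebra_simps)
qed

section \<open>Pointwise bounds on valuations and on the optimum\<close>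

lemma valuation_bounds:
  assumes "\<And>j. j < k \<Longrightarrow> \<sigma> j \<in> unit_cube" "X \<subseteq> {..<k}"
  shows "0 \<le> valuation \<sigma> i X" "valuation \<sigma> i X \<le> real k"
proof -
  have e: "0 \<le> \<sigma> e $ i" "\<sigma> e $ i \<le> 1" if "e \<in> X" for e
    using assms that by (auto simp: unit_cube_def)
  then show "0 \<le> valuation \<sigma> i X"
    unfolding valuation_def by (intro sum_nonneg)
  have "valuation \<sigma> i X \<le> (\<Sum>e\<in>X. 1)"
    unfolding valuation_def by (intro sum_mono e)
  also have "\<dots> \<le> real k"
    using card_mono[OF _ assms(2)] by simp
  finally show "valuation \<sigma> i X \<le> real k" .
qed

lemma min_value_le: "min_value \<sigma> A \<le> valuation \<sigma> i (A i)"
  unfolding min_value_def by (intro Min_le) auto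

lemma min_value_bounds:
  assumes "\<And>j. j < k \<Longrightarrow> \<sigma> j \<in> unit_cube" "\<And>i. A i \<subseteq> {..<k}"
  shows "0 \<le> min_value \<sigma> A" "min_value \<sigma> A \<le> real k"
proof -
  show "0 \<le> min_value \<sigma> A"
    unfolding min_value_def using valuation_bounds(1)[OF assms] by (intro Min.boundedI) auto
  show "min_value \<sigma> A \<le> real k"
    using order_trans[OF min_value_le valuation_bounds(2)[OF assms]] .
qed

lemma finite_allocations: "finite (allocations m :: ('n::finite \<Rightarrow> nat set) set)"
proof (rule finite_subset)
  show "allocations m \<subseteq> (\<Pi>\<^sub>E i\<in>(UNIV :: 'n set). Pow {..<m})"
    by (auto simp: allocations_def)
qed (auto intro: finite_PiE)

lemma allocations_nonempty: "(allocations m :: ('n::finite \<Rightarrow> nat set) set) \<noteq> {}"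
proof -
  \<comment> \<open>One arbitrary agent, named by \<open>undefined\<close>, receives every
    item.\<close>
  have "(\<lambda>i. if i = undefined then {..<m} else {}) \<in> (allocations m :: ('n \<Rightarrow> nat set) set)"
    by (auto simp: allocations_def disjoint_family_on_def)
  then show ?thesis
    by blast
qed

lemma OPT_attained: obtains A where "A \<in> allocations m" "OPT m \<sigma> = min_value \<sigma> A"
proof -
  have "OPT m \<sigma> \<in> min_value \<sigma> ` allocations m"
    unfolding OPT_def by (intro Max_in) (simp_all add: finite_allocations allocations_nonempty)
  with that show ?thesis
    by blast
qed

lemma OPT_bounds:
  assumes "\<And>j. j < m \<Longrightarrow> \<sigma> j \<in> unit_cube"
  shows "0 \<le> OPT m \<sigma>" "OPT m \<sigma> \<le> real m"
proof -
  obtain A where A: "A \<in> allocations m" "OPT m \<sigma> = min_value \<sigma> A"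
    by (rule OPT_attained)
  have "\<And>i. A i \<subseteq> {..<m}"
    using A(1) by (auto simp: allocations_def)
  then show "0 \<le> OPT m \<sigma>" "OPT m \<sigma> \<le> real m"
    using min_value_bounds[OF assms] A(2) by simp_all
qed

section \<open>Weighted greedy value against the optimum\<close>

definition greedy_score :: "('n::finite \<Rightarrow> real) \<Rightarrow> real ^ 'n \<Rightarrow> real" where
  "greedy_score w y = (MAX i. w i * y $ i)"

lemma greedy_score_ge: "w i * y $ i \<le> greedy_score w y"
  unfolding greedy_score_def by (intro Max_ge) auto

text \<open>In an optimal allocation every agent has value at least \<open>OPT m \<sigma>\<close>,
  so the weighted total is at least the left side. Counted item by item, the same total is at most
  the right side, because an item contributes at most its greedy score whoever owns it.\<close>

lemma weighted_OPT_le: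
  fixes w :: "'n::finite \<Rightarrow> real"
  assumes "\<And>i. 0 \<le> w i"
  shows "(\<Sum>i\<in>UNIV. w i) * OPT m \<sigma> \<le> (\<Sum>j<m. greedy_score w (\<sigma> j))"
proof -
  obtain A :: "'n \<Rightarrow> nat set" where A: "A \<in> allocations m" "OPT m \<sigma> = min_value \<sigma> A"
    by (rule OPT_attained)
  have fin: "finite (A i)" for i
  proof (rule finite_subset)
    show "A i \<subseteq> {..<m}"
      using A(1) by (auto simp: allocations_def)
  qed simp
  have "(\<Sum>i\<in>UNIV. w i) * OPT m \<sigma> = (\<Sum>i\<in>UNIV. w i * min_value \<sigma> A)"
    by (simp add: A(2) sum_distrib_right)
  also have "\<dots> \<le> (\<Sum>i\<in>UNIV. w i * valuation \<sigma> i (A i))"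
    by (intro sum_mono mult_left_mono min_value_le assms)
  also have "\<dots> = (\<Sum>i\<in>UNIV. \<Sum>j\<in>A i. w i * \<sigma> j $ i)"
    by (simp add: valuation_def sum_distrib_left)
  also have "\<dots> \<le> (\<Sum>i\<in>UNIV. \<Sum>j\<in>A i. greedy_score w (\<sigma> j))"
    by (intro sum_mono greedy_score_ge)
  also have "\<dots> = (\<Sum>j\<in>(\<Union>i. A i). greedy_score w (\<sigma> j))"
    using A(1) fin
    by (intro sum.UNION_disjoint[symmetric]) (auto simp: allocations_def disjoint_family_on_def)
  also have "(\<Union>i. A i) = {..<m}"
    using A(1) by (simp add: allocations_def)
  finally show ?thesis .
qed

section \<open>The run depends only on items already seen\<close>

lemma recipient_cong:
  assumes "\<And>l. l \<le> j \<Longrightarrow> \<sigma> l = \<tau> l"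
  shows "recipient d \<sigma> j = recipient d \<tau> j"
proof -
  have "restrict \<sigma> {..j} = restrict \<tau> {..j}"
    using assms by (auto simp: restrict_def)
  then show ?thesis
    by (simp add: recipient_def)
qed

lemma bundles_subset: "bundles d \<sigma> k i \<subseteq> {..<k}"
  by (induction k) (auto simp: less_Suc_eq)

text \<open>The online property of the rule. It allows items from \<open>k\<close> on to be changed
  without touching the first \<open>k\<close> decisions: later entries can be padded to stay in the
  cube, and item \<open>k\<close> can be averaged over while the past is fixed.\<close>

lemma bundles_cong:
  assumes "\<And>l. l < k \<Longrightarrow> \<sigma> l = \<tau> l"
  shows "bundles d \<sigma> k = bundles d \<tau> k"
  using assms
proof (induction k)
  case (Suc k)
  then have "recipient d \<sigma> k = recipient d \<tau> k"
    by (intro recipient_cong) auto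
  moreover have "bundles d \<sigma> k = bundles d \<tau> k"
    using Suc by simp
  ultimately show ?case
    by (simp add: fun_eq_iff)
qed simp

lemma valuation_bundles_cong:
  assumes "\<And>l. l < k \<Longrightarrow> \<sigma> l = \<tau> l"
  shows "valuation \<sigma> i (bundles d \<sigma> k i) = valuation \<tau> i (bundles d \<tau> k i)"
  unfolding valuation_def
proof (rule sum.cong)
  show "bundles d \<sigma> k i = bundles d \<tau> k i"
    using bundles_cong[of k \<sigma> \<tau> d] assms by simp
  show "\<sigma> e $ i = \<tau> e $ i" if "e \<in> bundles d \<tau> k i" for e
    using that bundles_subset[of d \<tau> k i] assms by auto
qed

lemma valuation_bundles_Suc:
  "valuation \<sigma> i (bundles d \<sigma> (Suc k) i) =
     valuation \<sigma> i (bundles d \<sigma> k i) + (if i = recipient d \<sigma> k then \<sigma> k $ i else 0)"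
proof -
  have "finite (bundles d \<sigma> k i)" "k \<notin> bundles d \<sigma> k i"
    using bundles_subset[of d \<sigma> k i] finite_subset by auto
  then show ?thesis
    by (auto simp: valuation_def)
qed

section \<open>The potential and its decrease per item\<close>

definition weight :: "real \<Rightarrow> 'n::finite online_rule \<Rightarrow> nat \<Rightarrow> (nat \<Rightarrow> real ^ 'n) \<Rightarrow> 'n \<Rightarrow> real" where
  "weight \<epsilon> d k \<sigma> i = (1 - \<epsilon>) powr valuation \<sigma> i (bundles d \<sigma> k i)"

definition potential :: "real \<Rightarrow> 'n::finite online_rule \<Rightarrow> nat \<Rightarrow> (nat \<Rightarrow> real ^ 'n) \<Rightarrow> real" where
  "potential \<epsilon> d k \<sigma> = (\<Sum>i\<in>UNIV. weight \<epsilon> d k \<sigma> i)"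

lemma weight_nonneg: "0 \<le> weight \<epsilon> d k \<sigma> i"
  by (simp add: weight_def)

lemma weight_le_1:
  assumes "0 < \<epsilon>" "\<epsilon> < 1" "\<And>j. j < k \<Longrightarrow> \<sigma> j \<in> unit_cube"
  shows "weight \<epsilon> d k \<sigma> i \<le> 1"
  unfolding weight_def using assms valuation_bounds(1)[OF assms(3) bundles_subset]
  by (intro powr_le1) auto

lemma weight_cong:
  assumes "\<And>l. l < k \<Longrightarrow> \<sigma> l = \<tau> l"
  shows "weight \<epsilon> d k \<sigma> i = weight \<epsilon> d k \<tau> i"
  unfolding weight_def using valuation_bundles_cong[of k \<sigma> \<tau>] assms by simp

lemma potential_bounds:
  fixes d :: "'n::finite online_rule"
  assumes "0 < \<epsilon>" "\<epsilon> < 1" "\<And>j. j < k \<Longrightarrow> \<sigma> j \<in> unit_cube"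
  shows "0 \<le> potential \<epsilon> d k \<sigma>" "potential \<epsilon> d k \<sigma> \<le> real CARD('n)"
proof -
  show "0 \<le> potential \<epsilon> d k \<sigma>"
    unfolding potential_def by (intro sum_nonneg weight_nonneg)
  have "potential \<epsilon> d k \<sigma> \<le> (\<Sum>i\<in>(UNIV::'n set). 1)"
    unfolding potential_def by (intro sum_mono weight_le_1 assms)
  then show "potential \<epsilon> d k \<sigma> \<le> real CARD('n)"
    by simp
qed

text \<open>The items after item \<open>k\<close> need not lie in the unit cube (the extensional functions of the
  product measure are \<open>undefined\<close> there), so \<^const>\<open>is_alg_B\<close> is applied to a modified sequence.\<close>

lemma is_alg_B_greedy:
  assumes "is_alg_B \<epsilon> d" "\<And>j. j \<le> k \<Longrightarrow> \<sigma> j \<in> unit_cube"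
  shows "weight \<epsilon> d k \<sigma> (recipient d \<sigma> k) * \<sigma> k $ recipient d \<sigma> k
    = greedy_score (weight \<epsilon> d k \<sigma>) (\<sigma> k)"
proof -
  define \<tau> where "\<tau> j = (if j \<le> k then \<sigma> j else 0)" for j
  have "range \<tau> \<subseteq> unit_cube"
    using assms(2) by (auto simp: \<tau>_def unit_cube_def)
  then have *: "is_arg_max (\<lambda>i. weight \<epsilon> d k \<tau> i * \<tau> k $ i) (\<lambda>i. True) (recipient d \<tau> k)"
    using assms(1) by (simp add: is_alg_B_def weight_def)
  have "recipient d \<tau> k = recipient d \<sigma> k"
    by (intro recipient_cong) (simp add: \<tau>_def)
  moreover have "weight \<epsilon> d k \<tau> i = weight \<epsilon> d k \<sigma> i" for i
    by (intro weight_cong) (simp add: \<tau>_def)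
  ultimately have "is_arg_max (\<lambda>i. weight \<epsilon> d k \<sigma> i * \<sigma> k $ i) (\<lambda>i. True) (recipient d \<sigma> k)"
    using * by (simp add: \<tau>_def)
  then show ?thesis
    unfolding greedy_score_def is_arg_max_def
    by (intro Max_eqI[symmetric]) (auto simp: not_less)
qed

text \<open>Only the recipient's weight changes, and the chord bound shows that it loses at least
  \<epsilon> times the recipient's score. By the choice of the algorithm that score is the greedy
  score.\<close>

lemma potential_Suc_le:
  fixes d :: "'n::finite online_rule"
  assumes "0 < \<epsilon>" "\<epsilon> < 1" "is_alg_B \<epsilon> d" "\<And>j. j \<le> k \<Longrightarrow> \<sigma> j \<in> unit_cube"
  shows "potential \<epsilon> d (Suc k) \<sigma>
    \<le> potential \<epsilon> d k \<sigma> - \<epsilon> * greedy_score (weight \<epsilon> d k \<sigma>) (\<sigma> k)"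
proof -
  define r where "r = recipient d \<sigma> k"
  have "weight \<epsilon> d (Suc k) \<sigma> i
      \<le> weight \<epsilon> d k \<sigma> i - (if i = r then \<epsilon> * (weight \<epsilon> d k \<sigma> r * \<sigma> k $ r) else 0)" for i
  proof (cases "i = r")
    case True
    have "weight \<epsilon> d (Suc k) \<sigma> r = weight \<epsilon> d k \<sigma> r * (1 - \<epsilon>) powr (\<sigma> k $ r)"
      unfolding weight_def valuation_bundles_Suc by (simp add: r_def powr_add)
    also have "\<dots> \<le> weight \<epsilon> d k \<sigma> r * (1 - \<epsilon> * \<sigma> k $ r)"
      using assms(1,2) assms(4)[of k]
      by (intro mult_left_mono powr_le_linear_interpolation weight_nonneg) (auto simp: unit_cube_def)
    finally show ?thesis
      using True by (simp add: algebra_simps)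
  next
    case False
    then show ?thesis
      unfolding weight_def valuation_bundles_Suc by (simp add: r_def)
  qed
  then have "potential \<epsilon> d (Suc k) \<sigma>
      \<le> (\<Sum>i\<in>UNIV. weight \<epsilon> d k \<sigma> i - (if i = r then \<epsilon> * (weight \<epsilon> d k \<sigma> r * \<sigma> k $ r) else 0))"
    unfolding potential_def by (intro sum_mono)
  also have "\<dots> = potential \<epsilon> d k \<sigma> - \<epsilon> * (weight \<epsilon> d k \<sigma> r * \<sigma> k $ r)"
    by (simp add: potential_def sum_subtractf)
  finally show ?thesis
    using is_alg_B_greedy[of \<epsilon> d k \<sigma>] assms(3,4) by (simp add: r_def)
qed

text \<open>The agent attaining the minimum contributes exactly the left side to a sum of
  nonnegative terms.\<close>

lemma powr_min_value_le_potential: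
  fixes d :: "'n::finite online_rule"
  shows "(1 - \<epsilon>) powr min_value \<sigma> (bundles d \<sigma> k) \<le> potential \<epsilon> d k \<sigma>"
proof -
  have "min_value \<sigma> (bundles d \<sigma> k) \<in> range (\<lambda>i. valuation \<sigma> i (bundles d \<sigma> k i))"
    unfolding min_value_def by (intro Min_in) auto
  then obtain i where "(1 - \<epsilon>) powr min_value \<sigma> (bundles d \<sigma> k) = weight \<epsilon> d k \<sigma> i"
    by (auto simp: weight_def)
  also have "\<dots> \<le> potential \<epsilon> d k \<sigma>"
    unfolding potential_def by (intro member_le_sum weight_nonneg) auto
  finally show ?thesis .
qed

section \<open>Expectations over independent items\<close>

locale item_distribution = prob_space D for D :: "(real ^ 'n::finite) measure" +
  assumes sets_D: "sets D = sets (restrict_space borel unit_cube)"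
begin

abbreviation P :: "nat \<Rightarrow> (nat \<Rightarrow> real ^ 'n) measure" where
  "P k \<equiv> PiM {..<k} (\<lambda>_. D)"

text \<open>The sigma-algebra determines the space. Hence sampled items lie in the cube at every
  point of \<open>P k\<close>, not merely almost everywhere.\<close>

lemma space_D: "space D = unit_cube"
  using sets_eq_imp_space_eq[OF sets_D] by (simp add: space_restrict_space)

lemma prob_space_P: "prob_space (P k)"
  by (intro prob_space_PiM prob_space_axioms)

lemma space_P_unit_cube: "\<sigma> \<in> space (P k) \<Longrightarrow> j < k \<Longrightarrow> \<sigma> j \<in> unit_cube"
  using space_D by (auto simp: space_PiM)

lemma nth_measurable [measurable]: "(\<lambda>y. y $ i) \<in> borel_measurable D"
proof -
  have "(\<lambda>y. y $ i) \<in> borel_measurable (restrict_space borel (unit_cube :: (real ^ 'n) set))"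
    by (intro measurable_restrict_space1 borel_measurable_continuous_onI continuous_intros)
  then show ?thesis
    by (simp cong: measurable_cong_sets add: sets_D)
qed

lemma item_measurable:
  assumes "j < k"
  shows "(\<lambda>\<sigma>. \<sigma> j $ i) \<in> borel_measurable (P k)"
  using measurable_compose[OF measurable_component_singleton[of j "{..<k}" "\<lambda>_. D"] nth_measurable]
    assms
  by simp

lemma integrable_bounded:
  assumes "f \<in> borel_measurable (P k)" "\<And>\<sigma>. \<sigma> \<in> space (P k) \<Longrightarrow> 0 \<le> f \<sigma> \<and> f \<sigma> \<le> (b::real)"
  shows "integrable (P k) f"
proof -
  interpret P: prob_space "P k"
    by (rule prob_space_P)
  show ?thesis
    using assms by (intro P.integrable_const_bound[of _ b] AE_I2) auto
qed

lemma min_value_measurable: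
  assumes "A \<in> allocations m"
  shows "(\<lambda>\<sigma>. min_value \<sigma> A) \<in> borel_measurable (P m)"
proof -
  have "\<And>i. A i \<subseteq> {..<m}"
    using assms by (auto simp: allocations_def)
  then show ?thesis
    unfolding min_value_def valuation_def
    by (intro borel_measurable_Min borel_measurable_sum item_measurable) auto
qed

lemma OPT_integrable: "integrable (P m) (OPT m)"
proof (rule integrable_bounded)
  show "OPT m \<in> borel_measurable (P m)"
    unfolding OPT_def
    by (intro borel_measurable_Max min_value_measurable finite_allocations)
  show "0 \<le> OPT m \<sigma> \<and> OPT m \<sigma> \<le> real m" if "\<sigma> \<in> space (P m)" for \<sigma>
    using OPT_bounds[OF space_P_unit_cube[OF that]] by simp
qed

lemma greedy_score_integrable: "integrable D (greedy_score w)"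
\<comment> \<open>Weights of either sign are covered, hence the absolute values in the
  bound.\<close>
proof (rule integrable_const_bound[where B = "\<Sum>i\<in>UNIV. \<bar>w i\<bar>"])
  show "greedy_score w \<in> borel_measurable D"
    unfolding greedy_score_def by measurable
  have "\<bar>greedy_score w y\<bar> \<le> (\<Sum>i\<in>UNIV. \<bar>w i\<bar>)" if "y \<in> space D" for y
  proof -
    have "greedy_score w y \<in> range (\<lambda>i. w i * y $ i)"
      unfolding greedy_score_def by (intro Max_in) auto
    then obtain i where i: "greedy_score w y = w i * y $ i"
      by auto
    have "\<bar>w i * y $ i\<bar> \<le> \<bar>w i\<bar> * 1"
      unfolding abs_mult using that by (intro mult_left_mono) (auto simp: space_D unit_cube_def)
    also have "\<dots> \<le> (\<Sum>i\<in>UNIV. \<bar>w i\<bar>)"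
      using member_le_sum[of i UNIV "\<lambda>i. \<bar>w i\<bar>"] by simp
    finally show ?thesis
      by (simp add: i)
  qed
  then show "AE y in D. norm (greedy_score w y) \<le> (\<Sum>i\<in>UNIV. \<bar>w i\<bar>)"
    by (intro AE_I2) simp
qed

text \<open>Each coordinate of \<open>P m\<close> has law \<open>D\<close>, so integrating
  \<open>weighted_OPT_le\<close> turns its right side into \<open>m\<close> equal terms. The weights
  are constants here; those of the run are substituted once its past is fixed.\<close>

lemma expected_greedy_score_ge:
  fixes w :: "'n \<Rightarrow> real"
  assumes "\<And>i. 0 \<le> w i"
  shows "(\<Sum>i\<in>UNIV. w i) * (LINT \<sigma>|P m. OPT m \<sigma>) \<le> real m * (LINT y|D. greedy_score w y)"
proof -
  have distr: "distr (P m) D (\<lambda>\<sigma>. \<sigma> j) = D" if "j < m" for j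
    using that by (intro distr_PiM_component prob_space_axioms) simp
  have comp: "integrable (P m) (\<lambda>\<sigma>. greedy_score w (\<sigma> j))"
    "(LINT \<sigma>|P m. greedy_score w (\<sigma> j)) = (LINT y|D. greedy_score w y)" if "j < m" for j
  proof -
    have meas: "(\<lambda>\<sigma>. \<sigma> j) \<in> measurable (P m) D"
      using that by (intro measurable_component_singleton) simp
    show "integrable (P m) (\<lambda>\<sigma>. greedy_score w (\<sigma> j))"
      using integrable_distr[OF meas, of "greedy_score w"] greedy_score_integrable[of w]
      by (simp add: distr[OF that])
    show "(LINT \<sigma>|P m. greedy_score w (\<sigma> j)) = (LINT y|D. greedy_score w y)"
      using integral_distr[OF meas borel_measurable_integrable[OF greedy_score_integrable[of w]]]
      by (simp add: distr[OF that])
  qed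
  have "(\<Sum>i\<in>UNIV. w i) * (LINT \<sigma>|P m. OPT m \<sigma>) = (LINT \<sigma>|P m. (\<Sum>i\<in>UNIV. w i) * OPT m \<sigma>)"
    by simp
  also have "\<dots> \<le> (LINT \<sigma>|P m. (\<Sum>j<m. greedy_score w (\<sigma> j)))"
    using OPT_integrable comp(1)
    by (intro integral_mono weighted_OPT_le assms Bochner_Integration.integrable_sum) auto
  also have "\<dots> = (\<Sum>j<m. LINT \<sigma>|P m. greedy_score w (\<sigma> j))"
    using comp(1) by (intro Bochner_Integration.integral_sum) auto
  also have "\<dots> = real m * (LINT y|D. greedy_score w y)"
    by (simp add: comp(2))
  finally show ?thesis .
qed

end

section \<open>Expected potential of the run\<close>

locale iid_alg_B = item_distribution D for D :: "(real ^ 'n::finite) measure" +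
  fixes \<epsilon> :: real and d :: "'n online_rule"
  assumes eps: "0 < \<epsilon>" "\<epsilon> < 1"
    and alg_B: "is_alg_B \<epsilon> d"
    and rule_measurable: "d j \<in> measurable (PiM {..j} (\<lambda>_. D)) (count_space UNIV)"
begin

text \<open>The argmax condition leaves ties open, so measurability of the decisions comes from
  \<open>rule_measurable\<close>, composed with the restriction to the items seen.\<close>

lemma recipient_measurable:
  assumes "j < k"
  shows "(\<lambda>\<sigma>. recipient d \<sigma> j) \<in> measurable (P k) (count_space UNIV)"
  unfolding recipient_def
  using assms by (intro measurable_compose[OF measurable_restrict_subset rule_measurable]) auto

text \<open>The recursion for the real-valued valuations is followed along the run, which avoids a
  sigma-algebra on bundles.\<close>

lemma valuation_bundles_measurable:
  "j \<le> k \<Longrightarrow> (\<lambda>\<sigma>. valuation \<sigma> i (bundles d \<sigma> j i)) \<in> borel_measurable (P k)"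
proof (induction j)
  case 0
  show ?case
    by (simp add: valuation_def)
next
  case (Suc j)
  have [measurable]: "(\<lambda>\<sigma>. recipient d \<sigma> j) \<in> measurable (P k) (count_space UNIV)"
    "(\<lambda>\<sigma>. \<sigma> j $ i) \<in> borel_measurable (P k)"
    "(\<lambda>\<sigma>. valuation \<sigma> i (bundles d \<sigma> j i)) \<in> borel_measurable (P k)"
    using Suc recipient_measurable item_measurable by auto
  show ?case
    unfolding valuation_bundles_Suc by measurable
qed

lemma potential_integrable: "integrable (P k) (potential \<epsilon> d k)"
proof (rule integrable_bounded)
  have [measurable]: "(\<lambda>\<sigma>. valuation \<sigma> i (bundles d \<sigma> k i)) \<in> borel_measurable (P k)" for i
    by (intro valuation_bundles_measurable) simp
  show "potential \<epsilon> d k \<in> borel_measurable (P k)"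
    unfolding potential_def weight_def by measurable
  show "0 \<le> potential \<epsilon> d k \<sigma> \<and> potential \<epsilon> d k \<sigma> \<le> real CARD('n)" if "\<sigma> \<in> space (P k)" for \<sigma>
    using potential_bounds[OF eps space_P_unit_cube[OF that]] by simp
qed

lemma min_value_bundles_measurable:
  "(\<lambda>\<sigma>. min_value \<sigma> (bundles d \<sigma> k)) \<in> borel_measurable (P k)"
  unfolding min_value_def by (intro borel_measurable_Min valuation_bundles_measurable) auto

lemma min_value_bundles_bounds:
  assumes "\<sigma> \<in> space (P k)"
  shows "0 \<le> min_value \<sigma> (bundles d \<sigma> k) \<and> min_value \<sigma> (bundles d \<sigma> k) \<le> real k"
  using min_value_bounds[where k = k and \<sigma> = \<sigma> and A = "bundles d \<sigma> k",
      OF space_P_unit_cube[OF assms] bundles_subset[of d \<sigma> k]] by simp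

lemma min_value_bundles_integrable: "integrable (P k) (\<lambda>\<sigma>. min_value \<sigma> (bundles d \<sigma> k))"
  using min_value_bundles_measurable min_value_bundles_bounds by (rule integrable_bounded)

text \<open>This is the conditional expectation given the past \<sigma>: item \<open>k\<close> is a
  fresh draw \<open>y\<close>, while the weights \<open>w\<close> are already determined.\<close>

lemma expected_next_potential_le:
  assumes "1 \<le> m" "\<sigma> \<in> space (P k)"
  shows "(LINT y|D. potential \<epsilon> d (Suc k) (\<sigma>(k := y)))
    \<le> exp (- \<epsilon> * (LINT \<sigma>|P m. OPT m \<sigma>) / real m) * potential \<epsilon> d k \<sigma>"
proof -
  \<comment> \<open>A lower bound on the expected fraction of the potential lost to one
    item.\<close>
  define x where "x = \<epsilon> * (LINT \<sigma>|P m. OPT m \<sigma>) / real m"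
  define w where "w = weight \<epsilon> d k \<sigma>"
  have cube: "(\<sigma>(k := y)) j \<in> unit_cube" if "y \<in> space D" "j < Suc k" for y j
    using that space_P_unit_cube[OF assms(2)] by (auto simp: space_D less_Suc_eq)
  have w_upd: "weight \<epsilon> d k (\<sigma>(k := y)) = w" for y
    unfolding w_def by (intro ext weight_cong) simp
  have step: "potential \<epsilon> d (Suc k) (\<sigma>(k := y)) \<le> (\<Sum>i\<in>UNIV. w i) - \<epsilon> * greedy_score w y"
    if "y \<in> space D" for y
    using potential_Suc_le[OF eps alg_B, of k "\<sigma>(k := y)"] cube[OF that]
    by (simp add: potential_def w_upd)
  have "(\<lambda>y. \<sigma>(k := y)) \<in> measurable D (P (Suc k))"
    using measurable_component_update[of \<sigma> "{..<k}" "\<lambda>_. D" k] assms(2) by (simp add: lessThan_Suc)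
  then have "(\<lambda>y. potential \<epsilon> d (Suc k) (\<sigma>(k := y))) \<in> borel_measurable D"
    using borel_measurable_integrable[OF potential_integrable] by (rule measurable_compose)
  then have "integrable D (\<lambda>y. potential \<epsilon> d (Suc k) (\<sigma>(k := y)))"
    using potential_bounds[OF eps, of "Suc k" "\<sigma>(k := y)" d for y] cube
    by (intro integrable_const_bound[of _ "real CARD('n)"] AE_I2) auto
  then have "(LINT y|D. potential \<epsilon> d (Suc k) (\<sigma>(k := y)))
      \<le> (LINT y|D. (\<Sum>i\<in>UNIV. w i) - \<epsilon> * greedy_score w y)"
    using greedy_score_integrable step by (intro integral_mono) auto
  also have "\<dots> = (\<Sum>i\<in>UNIV. w i) - \<epsilon> * (LINT y|D. greedy_score w y)"
    using greedy_score_integrable by (simp add: prob_space)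
  also have "\<dots> \<le> (\<Sum>i\<in>UNIV. w i) - \<epsilon> * ((\<Sum>i\<in>UNIV. w i) * (LINT \<sigma>|P m. OPT m \<sigma>) / real m)"
    using expected_greedy_score_ge[of w m] assms(1) eps
    by (intro diff_left_mono mult_left_mono) (auto simp: w_def weight_nonneg field_simps)
  also have "\<dots> = (1 - x) * potential \<epsilon> d k \<sigma>"
    by (simp add: x_def w_def potential_def algebra_simps)
  also have "\<dots> \<le> exp (- x) * potential \<epsilon> d k \<sigma>"
    using exp_ge_add_one_self[of "- x"] potential_bounds(1)[OF eps space_P_unit_cube[OF assms(2)]]
    by (intro mult_right_mono) auto
  finally show ?thesis
    by (simp add: x_def)
qed

text \<open>Fubini splits off the last item, and the one-step bound applies for each fixed past. The
  induction is on the number \<open>k\<close> of processed items, while \<open>m\<close> stays fixed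
  inside the rate.\<close>

lemma expected_potential_le:
  assumes "1 \<le> m"
  shows "(LINT \<sigma>|P k. potential \<epsilon> d k \<sigma>)
    \<le> exp (- \<epsilon> * (LINT \<sigma>|P m. OPT m \<sigma>) / real m) ^ k * real CARD('n)"
proof (induction k)
  case 0
  interpret P: prob_space "P 0"
    by (rule prob_space_P)
  have "(LINT \<sigma>|P 0. potential \<epsilon> d 0 \<sigma>) = real CARD('n)"
    using eps P.prob_space by (simp add: potential_def weight_def valuation_def)
  then show ?case
    by simp
next
  case (Suc k)
  define c where "c = exp (- \<epsilon> * (LINT \<sigma>|P m. OPT m \<sigma>) / real m)"
  interpret product_sigma_finite "\<lambda>_::nat. D"
    by unfold_locales
  interpret Pk: prob_space "P k"
    by (rule prob_space_P)
  have ins: "integrable (PiM (insert k {..<k}) (\<lambda>_. D)) (potential \<epsilon> d (Suc k))"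
    using potential_integrable[of "Suc k"] by (simp add: lessThan_Suc)
  have "(LINT \<sigma>|P (Suc k). potential \<epsilon> d (Suc k) \<sigma>)
      = (LINT \<sigma>|P k. LINT y|D. potential \<epsilon> d (Suc k) (\<sigma>(k := y)))"
    using product_integral_insert[OF _ _ ins] by (simp add: lessThan_Suc)
  also have "\<dots> \<le> (LINT \<sigma>|P k. c * potential \<epsilon> d k \<sigma>)"
  \<comment> \<open>This rule asks integrability and nonnegativity of the upper bound alone, which
    spares an argument for the inner integral as a function of \<sigma>.\<close>
  proof (rule integral_mono')
    show "integrable (P k) (\<lambda>\<sigma>. c * potential \<epsilon> d k \<sigma>)"
      using potential_integrable by simp
    show "(LINT y|D. potential \<epsilon> d (Suc k) (\<sigma>(k := y))) \<le> c * potential \<epsilon> d k \<sigma>"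
      if "\<sigma> \<in> space (P k)" for \<sigma>
      unfolding c_def by (rule expected_next_potential_le[OF assms that])
    show "0 \<le> c * potential \<epsilon> d k \<sigma>" if "\<sigma> \<in> space (P k)" for \<sigma>
      using potential_bounds(1)[OF eps space_P_unit_cube[OF that]] by (simp add: c_def)
  qed
  also have "\<dots> = c * (LINT \<sigma>|P k. potential \<epsilon> d k \<sigma>)"
    by simp
  also have "\<dots> \<le> c * (c ^ k * real CARD('n))"
    using Suc by (intro mult_left_mono) (auto simp: c_def)
  finally show ?case
    by (simp add: c_def mult.assoc)
qed

lemma expected_min_value_ge:
  assumes "1 \<le> m"
  shows "\<epsilon> * (LINT \<sigma>|P m. OPT m \<sigma>) - ln (real CARD('n))
    \<le> - ln (1 - \<epsilon>) * (LINT \<sigma>|P m. min_value \<sigma> (bundles d \<sigma> m))"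
proof -
  define O' where "O' = (LINT \<sigma>|P m. OPT m \<sigma>)"
  define X where "X = (\<lambda>\<sigma>. ln (1 - \<epsilon>) * min_value \<sigma> (bundles d \<sigma> m))"
  interpret P: prob_space "P m"
    by (rule prob_space_P)
  have expX: "exp (X \<sigma>) = (1 - \<epsilon>) powr min_value \<sigma> (bundles d \<sigma> m)" for \<sigma>
    using eps by (simp add: X_def powr_def mult.commute)
  have int: "integrable (P m) (\<lambda>\<sigma>. exp (X \<sigma>))"
  proof (rule integrable_bounded)
    show "(\<lambda>\<sigma>. exp (X \<sigma>)) \<in> borel_measurable (P m)"
      unfolding X_def using min_value_bundles_measurable by measurable
    show "0 \<le> exp (X \<sigma>) \<and> exp (X \<sigma>) \<le> 1" if "\<sigma> \<in> space (P m)" for \<sigma>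
      using eps min_value_bundles_bounds[OF that] by (auto simp: X_def intro!: mult_nonpos_nonneg)
  qed
  have "exp (LINT \<sigma>|P m. X \<sigma>) \<le> (LINT \<sigma>|P m. exp (X \<sigma>))"
    using int min_value_bundles_integrable
    by (intro P.jensens_inequality[of X UNIV] exp_convex) (auto simp: X_def)
  also have "\<dots> \<le> (LINT \<sigma>|P m. potential \<epsilon> d m \<sigma>)"
    using int potential_integrable
    by (intro integral_mono) (auto simp: expX powr_min_value_le_potential)
  also have "\<dots> \<le> exp (- \<epsilon> * O' / real m) ^ m * real CARD('n)"
    unfolding O'_def by (rule expected_potential_le[OF assms])
  \<comment> \<open>After exactly \<open>m\<close> items the divisor \<open>m\<close> in the rate
    cancels.\<close>
  also have "exp (- \<epsilon> * O' / real m) ^ m = exp (- \<epsilon> * O')"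
    using assms by (simp flip: exp_of_nat_mult)
  finally have "exp (LINT \<sigma>|P m. X \<sigma>) \<le> exp (- \<epsilon> * O' + ln (real CARD('n)))"
    unfolding exp_add by simp
  then have "(LINT \<sigma>|P m. X \<sigma>) \<le> - \<epsilon> * O' + ln (real CARD('n))"
    by (simp only: exp_le_cancel_iff)
  then show ?thesis
    by (simp add: X_def O'_def)
qed

end

section \<open>From the logarithmic bound to the ratio\<close>

lemma approximation_ratio_arithmetic:
  fixes \<epsilon> n Opt E :: real
  assumes "0 < \<epsilon>" "\<epsilon> < 1" "1 \<le> n" "0 \<le> E"
    and Opt: "2 / \<epsilon>\<^sup>2 * ln (n / \<epsilon>) \<le> Opt"
    and E: "\<epsilon> * Opt - ln n \<le> - ln (1 - \<epsilon>) * E"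
  shows "(1 - 2 * \<epsilon>) * Opt \<le> E"
proof -
  have n: "n \<le> n / \<epsilon>"
    using assms by (simp add: field_simps)
  have Opt': "ln (n / \<epsilon>) \<le> \<epsilon>\<^sup>2 / 2 * Opt"
    using Opt assms(1) by (simp add: field_simps)
  \<comment> \<open>The threshold on \<open>Opt\<close> thus absorbs the error term
    \<open>ln n\<close> into \<open>\<epsilon>\<^sup>2 / 2 * Opt\<close>.\<close>
  have "ln n \<le> ln (n / \<epsilon>)"
    using assms(3) n by (intro ln_mono) auto
  with Opt' assms(3) have ln_n: "0 \<le> ln n" "ln n \<le> \<epsilon>\<^sup>2 / 2 * Opt"
    by auto
  then have "0 \<le> \<epsilon>\<^sup>2 / 2 * Opt"
    by linarith
  then have "0 \<le> Opt"
    using assms(1) by (simp add: zero_le_mult_iff)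
  show ?thesis
  \<comment> \<open>Below 1/2 the factor \<open>1 - 2 * \<epsilon>\<close> is positive and may
    multiply the bound on the logarithm. Otherwise the target is nonpositive and
    \<open>0 \<le> E\<close> suffices.\<close>
  proof (cases "\<epsilon> < 1 / 2")
    case True
    have "ln (1 / (1 - \<epsilon>)) \<le> 1 / (1 - \<epsilon>) - 1"
      using assms by (intro ln_le_minus_one) auto
    then have L: "- ln (1 - \<epsilon>) \<le> \<epsilon> / (1 - \<epsilon>)"
      using assms by (simp add: ln_div field_simps)
    \<comment> \<open>After cancelling \<epsilon> and clearing the denominator this reads \<open>1 -
      2 * \<epsilon> \<le> (1 - \<epsilon> / 2) * (1 - \<epsilon>)\<close>.\<close>
    have "(1 - 2 * \<epsilon>) * (\<epsilon> / (1 - \<epsilon>)) \<le> \<epsilon> - \<epsilon>\<^sup>2 / 2"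
      using assms by (simp add: field_simps power2_eq_square)
    with L True have "- ln (1 - \<epsilon>) * (1 - 2 * \<epsilon>) \<le> \<epsilon> - \<epsilon>\<^sup>2 / 2"
      using mult_left_mono[OF L, of "1 - 2 * \<epsilon>"] by (simp add: mult.commute)
    from mult_right_mono[OF this \<open>0 \<le> Opt\<close>]
    have "- ln (1 - \<epsilon>) * ((1 - 2 * \<epsilon>) * Opt) \<le> \<epsilon> * Opt - \<epsilon>\<^sup>2 / 2 * Opt"
      by (simp add: algebra_simps)
    also have "\<dots> \<le> - ln (1 - \<epsilon>) * E"
      using E ln_n by simp
    finally show ?thesis
      using assms by (simp add: mult_le_cancel_left)
  next
    case False
    then have "(1 - 2 * \<epsilon>) * Opt \<le> 0"
      using \<open>0 \<le> Opt\<close> by (intro mult_nonpos_nonneg) auto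
    with assms show ?thesis
      by simp
  qed
qed

theorem theorem4:
  fixes \<epsilon> Opt :: real and m :: nat
    and D :: "(real ^ 'n::finite) measure"
    and d :: "'n online_rule"
  assumes "0 < \<epsilon>" and "\<epsilon> < 1" and "m \<ge> 1"
    and "prob_space D" and "sets D = sets (restrict_space borel unit_cube)"
    and "is_alg_B \<epsilon> d"
    and "\<And>j. d j \<in> measurable (PiM {..j} (\<lambda>_. D)) (count_space UNIV)"
    and "Opt = (LINT \<sigma>|PiM {..<m} (\<lambda>_. D). OPT m \<sigma>)"
    and "Opt \<ge> 2 / \<epsilon>\<^sup>2 * ln (real CARD('n) / \<epsilon>)"
  shows "(LINT \<sigma>|PiM {..<m} (\<lambda>_. D). min_value \<sigma> (bundles d \<sigma> m)) \<ge> (1 - 2 * \<epsilon>) * Opt"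
proof -
  interpret iid_alg_B D \<epsilon> d
    using assms
    by (intro iid_alg_B.intro item_distribution.intro item_distribution_axioms.intro
        iid_alg_B_axioms.intro)
  \<comment> \<open>This nonnegativity settles the case of \<epsilon> at least 1/2.\<close>
  have "0 \<le> (LINT \<sigma>|P m. min_value \<sigma> (bundles d \<sigma> m))"
    using min_value_bundles_bounds by (intro integral_nonneg_AE AE_I2) auto
  then show ?thesis
    using assms expected_min_value_ge[of m]
    by (intro approximation_ratio_arithmetic[of \<epsilon> "real CARD('n)"]) (auto simp: Suc_le_eq)
qed

end
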